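(* For any centered real-valued random variable $X$ (that is, $\mathbb{E}|X|<\infty$ and $\mathbb{E}X=0$), $$\sqrt{3/8}\,\cdot\,\|X\|_{\psi_2} \;\le\; \sigma_X \;\le\; \sqrt{\log 2}\,\cdot\,\|X\|_{\psi_2},$$ and both inequalities are sharp, i.e. the constant $\sqrt{3/8}$ cannot be replaced by any larger constant and the constant $\sqrt{\log 2}$ cannot be replaced by any smaller constant such that the corresponding inequality holds for all centered random variables $X$.
   Context: For a real-valued random variable $X$, the sub-Gaussian norm is $$\|X\|_{\psi_2} = \inf\{K>0 : \mathbb{E}\, e^{X^2/K^2} \le 2\},$$ and, for $X$ with $\mathbb{E}|X|<\infty$, the sub-Gaussian parameter is $$\sigma_X = \inf\{\sigma\ge 0 : \mathbb{E}\, e^{s(X-\mathbb{E}X)} \le e^{\sigma^2 s^2/2}\ \text{for all } s\in\mathbb{R}\}.$$ Both take values in $[0,\infty]$, with the convention $\inf\emptyset=\infty$. Here $\log$ is the natural logarithm. *)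

theory Defs
  imports "HOL-Probability.Probability"
begin

text \<open>
  Both quantities take values in \<open>[0, \<infinity>]\<close>, so they are infima in \<^typ>\<open>ennreal\<close>, where
  \<open>Inf {} = \<infinity>\<close>. The exponential moments are nonnegative Lebesgue integrals, since they may be
  infinite (a Bochner integral would then be \<open>0\<close>).
\<close>

definition subgaussian_norm :: "'a measure \<Rightarrow> ('a \<Rightarrow> real) \<Rightarrow> ennreal" where
  "subgaussian_norm M X =
     Inf {ennreal K | K :: real. 0 < K \<and>
            (\<integral>\<^sup>+ \<omega>. ennreal (exp ((X \<omega>)\<^sup>2 / K\<^sup>2)) \<partial>M) \<le> 2}"

definition subgaussian_param :: "'a measure \<Rightarrow> ('a \<Rightarrow> real) \<Rightarrow> ennreal" where
  "subgaussian_param M X =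
     Inf {ennreal \<sigma> | \<sigma> :: real. 0 \<le> \<sigma> \<and>
            (\<forall>s :: real. (\<integral>\<^sup>+ \<omega>. ennreal (exp (s * (X \<omega> - integral\<^sup>L M X))) \<partial>M)
                          \<le> ennreal (exp (\<sigma>\<^sup>2 * s\<^sup>2 / 2)))}"

definition centered_rv :: "'a measure \<Rightarrow> ('a \<Rightarrow> real) \<Rightarrow> bool" where
  "centered_rv M X \<longleftrightarrow> prob_space M \<and> integrable M X \<and> integral\<^sup>L M X = 0"

end

theory Submission
  imports Defs
begin

text \<open>
  Upper bound. By scaling, let \<open>E exp(X\<^sup>2) \<le> 2\<close> and put \<open>\<psi>(s) = ln E exp(sX)\<close>. Jensen's inequality
  under the measure with density \<open>exp(sX - \<psi>(s))\<close>, applied to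
  \<open>E exp(X\<^sup>2) = E\<^sub>s exp(X\<^sup>2 - sX + \<psi>(s))\<close>, gives \<open>\<psi>'' + \<psi>'\<^sup>2 - s\<psi>' + \<psi> \<le> ln 2\<close>, hence
  \<open>\<psi>'' + \<psi> \<le> ln 2 + s\<^sup>2/4\<close>. As \<open>1/4 \<le> (ln 2)/2\<close>, the function \<open>w = (ln 2) s\<^sup>2/2 - \<psi>\<close> satisfies
  \<open>w'' + w \<ge> 0\<close> and \<open>w(0) = w'(0) = 0\<close>, and so \<open>w \<ge> 0\<close> on \<open>[0, \<pi>]\<close>. For \<open>s \<ge> 3\<close> it suffices that
  \<open>sX \<le> X\<^sup>2 + s\<^sup>2/4\<close>. Equality holds for a symmetric sign times \<open>sqrt (ln 2)\<close>.

  Lower bound. Integrating \<open>E exp(sX) \<le> exp(\<sigma>\<^sup>2s\<^sup>2/2)\<close> over a centered Gaussian \<open>s\<close> of variance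
  \<open>3/(4\<sigma>\<^sup>2)\<close> gives exactly \<open>E exp(X\<^sup>2/K\<^sup>2) \<le> 2\<close> for \<open>K = sqrt(8/3) \<sigma>\<close>. Equality holds for Gaussian
  \<open>X\<close>.
\<close>

section \<open>Calculus: differentiation under the integral and a second-order comparison\<close>

section \<open>The upper bound\<close>

text \<open>Along any sequence tending to \<open>s\<close>, the mean value inequality on
  \<open>ball s r\<close> dominates the difference quotients by the integrable \<open>w\<close>, so
  dominated convergence applies.\<close>

lemma has_real_derivative_integral:
  fixes f f' :: "real \<Rightarrow> 'a \<Rightarrow> real"
  assumes r: "0 < r"
    and int: "\<And>t. \<bar>t - s\<bar> < r \<Longrightarrow> integrable M (f t)"
    and deriv: "\<And>t x. \<bar>t - s\<bar> < r \<Longrightarrow> x \<in> space M \<Longrightarrow> ((\<lambda>t. f t x) has_real_derivative f' t x) (at t)"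
    and bound: "\<And>t x. \<bar>t - s\<bar> < r \<Longrightarrow> x \<in> space M \<Longrightarrow> \<bar>f' t x\<bar> \<le> w x"
    and w: "integrable M w"
    and meas: "f' s \<in> borel_measurable M"
  shows "((\<lambda>t. integral\<^sup>L M (f t)) has_real_derivative integral\<^sup>L M (f' s)) (at s)"
  unfolding has_field_derivative_iff tendsto_at_iff_sequentially comp_def
proof (intro allI impI)
  fix X :: "nat \<Rightarrow> real"
  assume X: "\<forall>i. X i \<in> UNIV - {s}" and lim: "X \<longlonglongrightarrow> s"
  obtain N where N: "\<And>n. n \<ge> N \<Longrightarrow> \<bar>X n - s\<bar> < r"
    using lim r unfolding LIMSEQ_iff real_norm_def by blast
  \<comment> \<open>The sequence is only eventually inside the ball; the shift by \<open>N\<close>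
    is undone at the end by \<open>LIMSEQ_offset\<close>.\<close>
  define Y where "Y n = X (n + N)" for n
  have Y: "\<bar>Y n - s\<bar> < r" "Y n \<noteq> s" for n
    using N X by (auto simp: Y_def)
  have limY: "Y \<longlonglongrightarrow> s"
    unfolding Y_def by (rule LIMSEQ_ignore_initial_segment[OF lim])
  have int0: "integrable M (f s)" using int[of s] r by simp
  have "(\<lambda>n. integral\<^sup>L M (\<lambda>x. (f (Y n) x - f s x) / (Y n - s))) \<longlonglongrightarrow> integral\<^sup>L M (f' s)"
  proof (rule integral_dominated_convergence[where w = w])
    show "(\<lambda>x. (f (Y n) x - f s x) / (Y n - s)) \<in> borel_measurable M" for n
      using borel_measurable_integrable[OF int[OF Y(1)[of n]]] borel_measurable_integrable[OF int0]
      by measurable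
    show "AE x in M. (\<lambda>n. (f (Y n) x - f s x) / (Y n - s)) \<longlonglongrightarrow> f' s x"
    proof (rule AE_I2)
      fix x assume x: "x \<in> space M"
      have "((\<lambda>t. f t x) has_real_derivative f' s x) (at s)"
        by (rule deriv) (use x r in auto)
      then show "(\<lambda>n. (f (Y n) x - f s x) / (Y n - s)) \<longlonglongrightarrow> f' s x"
        unfolding has_field_derivative_iff tendsto_at_iff_sequentially comp_def
        using limY Y(2) by auto
    qed
    show "AE x in M. norm ((f (Y n) x - f s x) / (Y n - s)) \<le> w x" for n
    proof (rule AE_I2)
      fix x assume x: "x \<in> space M"
      have "norm (f (Y n) x - f s x) \<le> w x * norm (Y n - s)"
      proof (rule field_differentiable_bound[where S = "ball s r" and f' = "\<lambda>t. f' t x"])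
        show "((\<lambda>t. f t x) has_field_derivative f' t x) (at t within ball s r)"
          if "t \<in> ball s r" for t
          by (rule has_field_derivative_at_within[OF deriv[OF _ x]])
            (use that in \<open>simp add: dist_real_def abs_minus_commute\<close>)
        show "norm (f' t x) \<le> w x" if "t \<in> ball s r" for t
          using that bound[OF _ x, of t] by (simp add: dist_real_def abs_minus_commute)
      qed (use Y r in \<open>auto simp: dist_real_def abs_minus_commute\<close>)
      then show "norm ((f (Y n) x - f s x) / (Y n - s)) \<le> w x"
        using Y(2)[of n] by (simp add: divide_le_eq)
    qed
  qed (use meas w in auto)
  also have "(\<lambda>n. integral\<^sup>L M (\<lambda>x. (f (Y n) x - f s x) / (Y n - s))) =
      (\<lambda>n. (integral\<^sup>L M (f (Y n)) - integral\<^sup>L M (f s)) / (Y n - s))"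
    using int[OF Y(1)] int0 by simp
  finally show "(\<lambda>n. (integral\<^sup>L M (f (X n)) - integral\<^sup>L M (f s)) / (X n - s)) \<longlonglongrightarrow> integral\<^sup>L M (f' s)"
    unfolding Y_def by (rule LIMSEQ_offset)
qed

text \<open>Sturm comparison with the kernel sin(s - t), which is nonnegative on [0, s] as long as s
  <= pi. The Wronskian-type expression \<open>?g\<close> has derivative (w'' + w) sin(s - t),
  vanishes at 0 and equals \<open>w s\<close> at \<open>s\<close>.\<close>

lemma nonneg_if_deriv2_plus_self_nonneg:
  fixes w w' w'' :: "real \<Rightarrow> real"
  assumes w: "\<And>t. (w has_real_derivative w' t) (at t)"
    and w': "\<And>t. (w' has_real_derivative w'' t) (at t)"
    and pos: "\<And>t. w'' t + w t \<ge> 0"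
    and init: "w 0 = 0" "w' 0 = 0"
    and s: "0 \<le> s" "s \<le> pi"
  shows "w s \<ge> 0"
proof -
  let ?g = "\<lambda>t. w' t * sin (s - t) + w t * cos (s - t)"
  have "?g 0 \<le> ?g s"
  proof (rule DERIV_nonneg_imp_nondecreasing[OF s(1)])
    fix t assume t: "0 \<le> t" "t \<le> s"
    have "(?g has_real_derivative (w'' t + w t) * sin (s - t)) (at t)"
      by (auto intro!: derivative_eq_intros w w' simp: algebra_simps)
    moreover have "(w'' t + w t) * sin (s - t) \<ge> 0"
      using t s by (intro mult_nonneg_nonneg pos sin_ge_zero) auto
    ultimately show "\<exists>y. (?g has_real_derivative y) (at t) \<and> y \<ge> 0" by blast
  qed
  then show ?thesis by (simp add: init)
qed

text \<open>Half of exp(x^2) absorbs the polynomial, the other half absorbs exp(t x) by Young's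
  inequality. This gives integrability and a locally uniform majorant for every derivative of the
  moment generating function up to the second.\<close>

lemma abs_power_mult_exp_le:
  fixes x t :: real
  assumes "k \<le> 2"
  shows "\<bar>x ^ k * exp (t * x)\<bar> \<le> 2 * exp (t\<^sup>2 / 2) * exp (x\<^sup>2)"
proof -
  have e: "1 + x\<^sup>2 / 2 \<le> exp (x\<^sup>2 / 2)" by (rule exp_ge_add_one_self)
  have "2 * \<bar>x\<bar> \<le> 2 + x\<^sup>2"
    using zero_le_power2[of "\<bar>x\<bar> - 1"] by (simp add: power2_diff)
  moreover have "k = 0 \<or> k = 1 \<or> k = 2" using assms by auto
  ultimately have "\<bar>x ^ k\<bar> \<le> 2 + x\<^sup>2" by auto
  with e have 1: "\<bar>x ^ k\<bar> \<le> 2 * exp (x\<^sup>2 / 2)" by linarith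
  have "t * x \<le> t\<^sup>2 / 2 + x\<^sup>2 / 2"
    using zero_le_power2[of "t - x"] by (simp add: power2_diff)
  then have 2: "exp (t * x) \<le> exp (t\<^sup>2 / 2) * exp (x\<^sup>2 / 2)"
    by (simp flip: exp_add)
  have "\<bar>x ^ k * exp (t * x)\<bar> \<le> (2 * exp (x\<^sup>2 / 2)) * (exp (t\<^sup>2 / 2) * exp (x\<^sup>2 / 2))"
    unfolding abs_mult by (intro mult_mono 1) (use 2 in auto)
  also have "\<dots> = 2 * exp (t\<^sup>2 / 2) * (exp (x\<^sup>2 / 2) * exp (x\<^sup>2 / 2))" by simp
  also have "exp (x\<^sup>2 / 2) * exp (x\<^sup>2 / 2) = exp (x\<^sup>2)"
    by (simp flip: exp_add)
  finally show ?thesis .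
qed

section \<open>Tilted moments and the moment generating function when exp(X^2) is integrable\<close>

context prob_space
begin

context
  fixes X :: "'a \<Rightarrow> real"
  assumes X[measurable]: "random_variable borel X"
    and sq_exp: "integrable M (\<lambda>x. exp ((X x)\<^sup>2))"
begin

lemma integrable_power_mult_exp:
  assumes "k \<le> 2"
  shows "integrable M (\<lambda>x. X x ^ k * exp (t * X x))"
proof (rule Bochner_Integration.integrable_bound)
  show "integrable M (\<lambda>x. 2 * exp (t\<^sup>2 / 2) * exp ((X x)\<^sup>2))"
    using sq_exp by simp
qed (use abs_power_mult_exp_le[OF assms] in auto)

lemma integrable_exp_mult: "integrable M (\<lambda>x. exp (t * X x))"
  using integrable_power_mult_exp[of 0] by simp

lemma has_derivative_tilted_moment:
  assumes k: "k \<le> 1"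
  shows "((\<lambda>t. expectation (\<lambda>x. X x ^ k * exp (t * X x))) has_real_derivative
           expectation (\<lambda>x. X x ^ Suc k * exp (s * X x))) (at s)"
proof (rule has_real_derivative_integral[where r = 1
      and f = "\<lambda>t x. X x ^ k * exp (t * X x)" and f' = "\<lambda>t x. X x ^ Suc k * exp (t * X x)"
      and w = "\<lambda>x. 2 * exp ((\<bar>s\<bar> + 1)\<^sup>2 / 2) * exp ((X x)\<^sup>2)"])
  fix t x assume t: "\<bar>t - s\<bar> < 1"
  have "t\<^sup>2 \<le> (\<bar>s\<bar> + 1)\<^sup>2"
    using t by (subst abs_le_square_iff[symmetric]) auto
  then have "2 * exp (t\<^sup>2 / 2) * exp ((X x)\<^sup>2) \<le> 2 * exp ((\<bar>s\<bar> + 1)\<^sup>2 / 2) * exp ((X x)\<^sup>2)"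
    by simp
  then show "\<bar>X x ^ Suc k * exp (t * X x)\<bar> \<le> 2 * exp ((\<bar>s\<bar> + 1)\<^sup>2 / 2) * exp ((X x)\<^sup>2)"
    using abs_power_mult_exp_le[of "Suc k" "X x" t] k by linarith
  show "((\<lambda>t. X x ^ k * exp (t * X x)) has_real_derivative X x ^ Suc k * exp (t * X x)) (at t)"
    by (auto intro!: derivative_eq_intros)
next
  show "integrable M (\<lambda>x. X x ^ k * exp (t * X x))" for t
    by (rule integrable_power_mult_exp) (use k in simp)
qed (use sq_exp in auto)

lemma mgf_le_exp_ln2_nonneg:
  assumes le2: "expectation (\<lambda>x. exp ((X x)\<^sup>2)) \<le> 2"
    and EX: "expectation X = 0"
    and s: "0 \<le> s"
  shows "expectation (\<lambda>x. exp (s * X x)) \<le> exp (ln 2 * s\<^sup>2 / 2)"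
proof -
  define m where "m k t = expectation (\<lambda>x. X x ^ k * exp (t * X x))" for k and t :: real
  have mgf: "expectation (\<lambda>x. exp (t * X x)) = m 0 t" for t by (simp add: m_def)
  have m_int: "integrable M (\<lambda>x. X x ^ k * exp (t * X x))" if "k \<le> 2" for k t
    using that by (rule integrable_power_mult_exp)
  have m_pos: "m 0 t > 0" for t
  proof -
    have "m 0 t > expectation (\<lambda>x. 0)"
      unfolding m_def
      by (rule integral_less_AE_space) (use m_int[of 0] in \<open>auto simp: emeasure_space_1\<close>)
    then show ?thesis by simp
  qed
  have m_deriv: "(m k has_real_derivative m (Suc k) t) (at t)" if "k \<le> 1" for k t
    unfolding m_def using that by (rule has_derivative_tilted_moment)
  \<comment> \<open>This bound serves both ranges of \<open>s\<close>: it gives 1/4 <= (ln 2)/2 in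
    the differential inequality, and it exceeds 9/14, which is what s^2/4 + ln 2 <= (ln 2) s^2/2
    demands at s = 3.\<close>
  have L: "ln 2 \<ge> (2/3 :: real)" by (rule ln2_ge_two_thirds)
  show ?thesis
  \<comment> \<open>The threshold 3 lies below pi, the limit of the comparison argument, and is
    already large enough for the crude bound beyond it.\<close>
  proof (cases "s \<le> 3")
    case True
    define \<psi> where "\<psi> t = ln (m 0 t)" for t
    define \<psi>' where "\<psi>' t = m 1 t / m 0 t" for t
    define \<psi>'' where "\<psi>'' t = m 2 t / m 0 t - (m 1 t / m 0 t)\<^sup>2" for t
    have d1: "(\<psi> has_real_derivative \<psi>' t) (at t)" for t
      unfolding \<psi>_def \<psi>'_def
      by (auto intro!: derivative_eq_intros m_deriv m_pos)
    have d2: "(\<psi>' has_real_derivative \<psi>'' t) (at t)" for t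
      unfolding \<psi>'_def \<psi>''_def using m_pos[of t] m_deriv[of 1 t]
      by (auto intro!: derivative_eq_intros m_deriv simp: numeral_2_eq_2 field_simps power2_eq_square)
    have ineq: "\<psi>'' t + \<psi> t \<le> ln 2 + t\<^sup>2 / 4" for t
    proof -
      \<comment> \<open>\<open>c\<close> is the mean of X^2 - tX under the law tilted by exp(tX).
        Jensen's inequality is obtained by integrating the tangent line of exp at \<open>c\<close>,
        whose linear term has tilted mean zero.\<close>
      define c where "c = (m 2 t - t * m 1 t) / m 0 t"
      have pt: "exp (t * x) * exp c * (1 + (x\<^sup>2 - t * x - c)) \<le> exp (x\<^sup>2)" for x :: real
      proof -
        have "exp (t * x) * exp c * (1 + (x\<^sup>2 - t * x - c)) \<le>
            exp (t * x) * exp c * exp (x\<^sup>2 - t * x - c)"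
          by (intro mult_left_mono exp_ge_add_one_self) auto
        also have "\<dots> = exp (x\<^sup>2)" by (simp flip: exp_add)
        finally show ?thesis .
      qed
      \<comment> \<open>Written as a combination of the integrands of \<open>m 0 t\<close>,
        \<open>m 1 t\<close> and \<open>m 2 t\<close>, so that linearity of the integral
        applies.\<close>
      have eq: "exp (t * x) * exp c * (1 + (x\<^sup>2 - t * x - c)) =
          exp c * ((1 - c) * (x ^ 0 * exp (t * x)) + x ^ 2 * exp (t * x) - t * (x ^ 1 * exp (t * x)))"
        for x :: real by (simp add: algebra_simps)
      have "expectation (\<lambda>x. exp (t * X x) * exp c * (1 + ((X x)\<^sup>2 - t * X x - c))) \<le>
          expectation (\<lambda>x. exp ((X x)\<^sup>2))"
        unfolding eq
        by (intro integral_mono Bochner_Integration.integrable_add Bochner_Integration.integrable_diff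
            integrable_mult_right m_int sq_exp) (use pt eq in auto)
      also have "expectation (\<lambda>x. exp (t * X x) * exp c * (1 + ((X x)\<^sup>2 - t * X x - c))) =
          exp c * ((1 - c) * m 0 t + m 2 t - t * m 1 t)"
        unfolding eq m_def
        using m_int[of 0 t] m_int[of 1 t] m_int[of 2 t] by simp
      also have "\<dots> = exp c * m 0 t"
        using m_pos[of t] by (simp add: c_def field_simps)
      finally have "exp c * m 0 t \<le> 2" using le2 by linarith
      then have "ln (exp c * m 0 t) \<le> ln 2" using m_pos[of t] by simp
      then have "c + \<psi> t \<le> ln 2" using m_pos[of t] by (simp add: ln_mult \<psi>_def)
      moreover have "c = \<psi>'' t + (\<psi>' t)\<^sup>2 - t * \<psi>' t"
        by (simp add: c_def \<psi>''_def \<psi>'_def diff_divide_distrib)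
      \<comment> \<open>Completing the square removes the first derivative and leaves a linear
        inequality in the log moment generating function and its second derivative.\<close>
      moreover have "(\<psi>' t)\<^sup>2 - t * \<psi>' t \<ge> - (t\<^sup>2 / 4)"
        using zero_le_power2[of "\<psi>' t - t / 2"] by (simp add: power2_diff power_divide mult.commute)
      ultimately show ?thesis by linarith
    qed
    have "ln 2 * s\<^sup>2 / 2 - \<psi> s \<ge> 0"
    proof (rule nonneg_if_deriv2_plus_self_nonneg[where w = "\<lambda>t. ln 2 * t\<^sup>2 / 2 - \<psi> t"
          and w' = "\<lambda>t. ln 2 * t - \<psi>' t" and w'' = "\<lambda>t. ln 2 - \<psi>'' t"])
      show "((\<lambda>s. ln 2 * s\<^sup>2 / 2 - \<psi> s) has_real_derivative ln 2 * t - \<psi>' t) (at t)" for t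
        by (auto intro!: derivative_eq_intros d1)
      show "((\<lambda>t. ln 2 * t - \<psi>' t) has_real_derivative ln 2 - \<psi>'' t) (at t)" for t
        by (auto intro!: derivative_eq_intros d2)
      show "ln 2 - \<psi>'' t + (ln 2 * t\<^sup>2 / 2 - \<psi> t) \<ge> 0" for t
        using ineq[of t] mult_right_mono[OF L, of "t\<^sup>2"] zero_le_power2[of t] by linarith
      show "ln 2 * 0\<^sup>2 / 2 - \<psi> 0 = 0" "ln 2 * 0 - \<psi>' 0 = 0"
        using EX by (simp_all add: \<psi>_def \<psi>'_def m_def prob_space)
      show "s \<le> pi" using True pi_gt3 by linarith
    qed (rule s)
    then have "ln (m 0 s) \<le> ln 2 * s\<^sup>2 / 2" by (simp add: \<psi>_def)
    then show ?thesis
      using m_pos[of s] unfolding mgf by (metis exp_le_cancel_iff exp_ln)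
  next
    case False
    have "expectation (\<lambda>x. exp (s * X x)) \<le> expectation (\<lambda>x. exp (s\<^sup>2 / 4) * exp ((X x)\<^sup>2))"
    proof (rule integral_mono)
      show "exp (s * X x) \<le> exp (s\<^sup>2 / 4) * exp ((X x)\<^sup>2)" for x
        using zero_le_power2[of "X x - s / 2"]
        by (simp add: power2_diff power_divide mult.commute flip: exp_add)
    qed (use integrable_exp_mult sq_exp in auto)
    also have "\<dots> = exp (s\<^sup>2 / 4) * expectation (\<lambda>x. exp ((X x)\<^sup>2))" by simp
    also have "\<dots> \<le> exp (s\<^sup>2 / 4) * 2" using le2 by simp
    also have "\<dots> = exp (s\<^sup>2 / 4 + ln 2)" by (simp add: exp_add)
    also have "\<dots> \<le> exp (ln 2 * s\<^sup>2 / 2)"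
    proof -
      have "s\<^sup>2 \<ge> 3\<^sup>2" using False by (intro power_mono) auto
      then have "(ln 2 / 2 - 1 / 4) * s\<^sup>2 \<ge> (ln 2 / 2 - 1 / 4) * 9"
        using L by (intro mult_left_mono) auto
      then have "s\<^sup>2 / 4 + ln 2 \<le> ln 2 * s\<^sup>2 / 2" using L by (simp add: algebra_simps)
      then show ?thesis by simp
    qed
    finally show ?thesis .
  qed
qed

end

lemma mgf_le_exp_ln2:
  fixes X :: "'a \<Rightarrow> real"
  assumes X[measurable]: "random_variable borel X"
    and sq_exp: "integrable M (\<lambda>x. exp ((X x)\<^sup>2))" "expectation (\<lambda>x. exp ((X x)\<^sup>2)) \<le> 2"
    and EX: "expectation X = 0"
  shows "expectation (\<lambda>x. exp (s * X x)) \<le> exp (ln 2 * s\<^sup>2 / 2)"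
proof (cases "s \<ge> 0")
  case True
  with assms show ?thesis by (intro mgf_le_exp_ln2_nonneg)
next
  case False
  have "expectation (\<lambda>x. exp (- s * - X x)) \<le> exp (ln 2 * (- s)\<^sup>2 / 2)"
    using False assms by (intro mgf_le_exp_ln2_nonneg) auto
  then show ?thesis by simp
qed

text \<open>Rescaling to X/K reduces to the case K = 1. Finiteness of the nonnegative integral
  supplies the integrability that the Bochner version assumes.\<close>

lemma nn_mgf_le_of_nn_sq_exp_le:
  fixes X :: "'a \<Rightarrow> real"
  assumes X[measurable]: "random_variable borel X" and EX: "expectation X = 0" and K: "0 < K"
    and le2: "(\<integral>\<^sup>+ x. ennreal (exp ((X x)\<^sup>2 / K\<^sup>2)) \<partial>M) \<le> 2"
  shows "(\<integral>\<^sup>+ x. ennreal (exp (s * X x)) \<partial>M) \<le> ennreal (exp ((sqrt (ln 2) * K)\<^sup>2 * s\<^sup>2 / 2))"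
proof -
  define Y where "Y = (\<lambda>x. X x / K)"
  have [measurable]: "random_variable borel Y" unfolding Y_def by measurable
  have le2': "(\<integral>\<^sup>+ x. ennreal (exp ((Y x)\<^sup>2)) \<partial>M) \<le> 2"
    using le2 by (simp add: Y_def power_divide)
  have int: "integrable M (\<lambda>x. exp ((Y x)\<^sup>2))"
    by (rule integrableI_nonneg) (use le2' in \<open>auto intro: le_less_trans\<close>)
  have "ennreal (expectation (\<lambda>x. exp ((Y x)\<^sup>2))) \<le> ennreal 2"
    using le2' by (subst nn_integral_eq_integral[symmetric]) (use int in auto)
  then have "expectation (\<lambda>x. exp ((Y x)\<^sup>2)) \<le> 2"
    by (subst (asm) ennreal_le_iff) auto
  moreover have "expectation Y = 0" using EX by (simp add: Y_def)
  ultimately have "expectation (\<lambda>x. exp ((s * K) * Y x)) \<le> exp (ln 2 * (s * K)\<^sup>2 / 2)"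
    using int by (intro mgf_le_exp_ln2) auto
  moreover have "integrable M (\<lambda>x. exp ((s * K) * Y x))"
    by (rule integrable_exp_mult) (use int in auto)
  ultimately have "(\<integral>\<^sup>+ x. ennreal (exp ((s * K) * Y x)) \<partial>M) \<le> ennreal (exp (ln 2 * (s * K)\<^sup>2 / 2))"
    by (subst nn_integral_eq_integral) auto
  then show ?thesis
    using K by (simp add: Y_def power_mult_distrib mult_ac)
qed

end

text \<open>Moves a factor across the infimum: since \<open>c\<close> is positive and finite, one
  may divide by it, and \<open>a / ennreal c\<close> is then a lower bound of the admissible
  \<open>K\<close>. An empty set of such \<open>K\<close> needs no separate case.\<close>

lemma ennreal_mult_subgaussian_norm_ge:
  assumes c: "0 < c"
    and "\<And>K. 0 < K \<Longrightarrow> (\<integral>\<^sup>+ x. ennreal (exp ((X x)\<^sup>2 / K\<^sup>2)) \<partial>M) \<le> 2 \<Longrightarrow> a \<le> ennreal (c * K)"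
  shows "a \<le> ennreal c * subgaussian_norm M X"
proof -
  have "a / ennreal c \<le> subgaussian_norm M X"
    unfolding subgaussian_norm_def
  proof (rule Inf_greatest, clarify)
    fix K :: real assume "0 < K" "(\<integral>\<^sup>+ x. ennreal (exp ((X x)\<^sup>2 / K\<^sup>2)) \<partial>M) \<le> 2"
    then have "a \<le> ennreal K * ennreal c"
      using assms by (simp add: ennreal_mult mult.commute)
    then show "a / ennreal c \<le> ennreal K"
      using c by (simp add: divide_le_posI_ennreal mult.commute)
  qed
  then have "a / ennreal c * ennreal c \<le> subgaussian_norm M X * ennreal c"
    by (rule mult_right_mono) simp
  also have "a / ennreal c * ennreal c = a"
    using c by (simp add: ennreal_divide_times ennreal_divide_self)
  finally show ?thesis by (simp add: mult.commute)
qed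

lemma subgaussian_param_le:
  assumes X: "centered_rv M X"
  shows "subgaussian_param M X \<le> ennreal (sqrt (ln 2)) * subgaussian_norm M X"
proof (rule ennreal_mult_subgaussian_norm_ge)
  interpret prob_space M using X by (simp add: centered_rv_def)
  have EX: "expectation X = 0" and [measurable]: "random_variable borel X"
    using X by (auto simp: centered_rv_def)
  fix K :: real assume K: "0 < K" and le2: "(\<integral>\<^sup>+ x. ennreal (exp ((X x)\<^sup>2 / K\<^sup>2)) \<partial>M) \<le> 2"
  show "subgaussian_param M X \<le> ennreal (sqrt (ln 2) * K)"
    unfolding subgaussian_param_def
  proof (rule Inf_lower, intro CollectI exI conjI allI)
    show "ennreal (sqrt (ln 2) * K) = ennreal (sqrt (ln 2) * K)" ..
    show "0 \<le> sqrt (ln 2) * K" using K by simp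
    show "(\<integral>\<^sup>+ x. ennreal (exp (s * (X x - expectation X))) \<partial>M)
        \<le> ennreal (exp ((sqrt (ln 2) * K)\<^sup>2 * s\<^sup>2 / 2))" for s
      using nn_mgf_le_of_nn_sq_exp_le[OF _ EX K le2] by (simp add: EX)
  qed
qed simp

section \<open>The lower bound\<close>

lemma nn_integral_normal_density:
  "0 < \<sigma> \<Longrightarrow> (\<integral>\<^sup>+ x. ennreal (normal_density \<mu> \<sigma> x) \<partial>lborel) = 1"
  by (subst nn_integral_eq_integral) auto

text \<open>Completing the square in \<open>s\<close>: exponential tilting of a centered Gaussian
  only shifts its mean.\<close>

lemma exp_mult_normal_density:
  assumes "0 < \<tau>"
  shows "exp (s * x) * normal_density 0 \<tau> s = exp (\<tau>\<^sup>2 * x\<^sup>2 / 2) * normal_density (\<tau>\<^sup>2 * x) \<tau> s"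
proof -
  have "s * x - s\<^sup>2 / (2 * \<tau>\<^sup>2) = \<tau>\<^sup>2 * x\<^sup>2 / 2 - (s - \<tau>\<^sup>2 * x)\<^sup>2 / (2 * \<tau>\<^sup>2)"
    using assms by (simp add: field_simps power2_eq_square)
  then have "exp (s * x) * exp (- (s\<^sup>2 / (2 * \<tau>\<^sup>2))) =
      exp (\<tau>\<^sup>2 * x\<^sup>2 / 2) * exp (- ((s - \<tau>\<^sup>2 * x)\<^sup>2 / (2 * \<tau>\<^sup>2)))"
    by (simp flip: exp_add)
  then show ?thesis by (simp add: normal_density_def)
qed

lemma nn_integral_exp_mult_normal_density:
  assumes "0 < \<tau>"
  shows "(\<integral>\<^sup>+ s. ennreal (exp (s * x) * normal_density 0 \<tau> s) \<partial>lborel) = ennreal (exp (\<tau>\<^sup>2 * x\<^sup>2 / 2))"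
  unfolding exp_mult_normal_density[OF assms]
  by (simp add: ennreal_mult nn_integral_cmult nn_integral_normal_density assms)

text \<open>The quadratic factor turns the density into a multiple of the Gaussian density of
  variance \<open>\<tau>\<^sup>2 / d\<close>; the ratio of the normalizing constants is the value of
  the integral.\<close>

lemma nn_integral_exp_square_normal_density:
  assumes \<tau>: "0 < \<tau>" and a: "2 * a * \<tau>\<^sup>2 < 1"
  shows "(\<integral>\<^sup>+ s. ennreal (exp (a * s\<^sup>2) * normal_density 0 \<tau> s) \<partial>lborel)
           = ennreal (1 / sqrt (1 - 2 * a * \<tau>\<^sup>2))"
proof -
  define d where "d = 1 - 2 * a * \<tau>\<^sup>2"
  have d: "d > 0" using a by (simp add: d_def)
  define \<rho> where "\<rho> = \<tau> / sqrt d"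
  have \<rho>: "\<rho> > 0" "\<rho>\<^sup>2 = \<tau>\<^sup>2 / d" using \<tau> d by (auto simp: \<rho>_def power_divide)
  have "exp (a * s\<^sup>2) * normal_density 0 \<tau> s = 1 / sqrt d * normal_density 0 \<rho> s" for s
  proof -
    have "a * s\<^sup>2 - s\<^sup>2 / (2 * \<tau>\<^sup>2) = - (s\<^sup>2 / (2 * \<rho>\<^sup>2))"
      using \<tau> d unfolding \<rho>(2) by (simp add: d_def field_simps)
    then have "exp (a * s\<^sup>2) * exp (- (s\<^sup>2 / (2 * \<tau>\<^sup>2))) = exp (- (s\<^sup>2 / (2 * \<rho>\<^sup>2)))"
      by (simp flip: exp_add)
    moreover have "1 / sqrt (2 * pi * \<tau>\<^sup>2) = 1 / sqrt d * (1 / sqrt (2 * pi * \<rho>\<^sup>2))"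
      using \<tau> d unfolding \<rho>(2) by (simp add: real_sqrt_mult real_sqrt_divide)
    ultimately show ?thesis by (simp add: normal_density_def)
  qed
  then have "(\<integral>\<^sup>+ s. ennreal (exp (a * s\<^sup>2) * normal_density 0 \<tau> s) \<partial>lborel)
      = (\<integral>\<^sup>+ s. ennreal (1 / sqrt d) * ennreal (normal_density 0 \<rho> s) \<partial>lborel)"
    using d by (simp flip: ennreal_mult)
  also have "\<dots> = ennreal (1 / sqrt d)"
    using \<rho> by (simp add: nn_integral_cmult nn_integral_normal_density)
  finally show ?thesis by (simp add: d_def)
qed

lemma (in prob_space) nn_sq_exp_le_of_nn_mgf_le:
  fixes X :: "'a \<Rightarrow> real"
  assumes X[measurable]: "random_variable borel X" and \<sigma>: "0 < \<sigma>"
    and mgf: "\<And>s. (\<integral>\<^sup>+ x. ennreal (exp (s * X x)) \<partial>M) \<le> ennreal (exp (\<sigma>\<^sup>2 * s\<^sup>2 / 2))"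
  shows "(\<integral>\<^sup>+ x. ennreal (exp ((X x)\<^sup>2 / (sqrt (8/3) * \<sigma>)\<^sup>2)) \<partial>M) \<le> 2"
proof -
  \<comment> \<open>With this variance \<open>\<tau>\<^sup>2 / 2\<close> equals 1/K^2 for K =
    sqrt(8/3) \<open>\<sigma>\<close>, and 1 - \<open>\<sigma>\<^sup>2 * \<tau>\<^sup>2\<close> is
    1/4, so the final Gaussian integral is exactly 2.\<close>
  define \<tau> where "\<tau> = sqrt (3/4) / \<sigma>"
  have \<tau>: "\<tau> > 0" "\<tau>\<^sup>2 = 3 / (4 * \<sigma>\<^sup>2)" using \<sigma> by (auto simp: \<tau>_def power_divide)
  interpret pair_sigma_finite M lborel ..
  have "(\<integral>\<^sup>+ x. ennreal (exp ((X x)\<^sup>2 / (sqrt (8/3) * \<sigma>)\<^sup>2)) \<partial>M) =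
      (\<integral>\<^sup>+ x. ennreal (exp (\<tau>\<^sup>2 * (X x)\<^sup>2 / 2)) \<partial>M)"
    by (simp add: \<tau>(2) power_mult_distrib mult.commute)
  also have "\<dots> = (\<integral>\<^sup>+ x. (\<integral>\<^sup>+ s. ennreal (exp (s * X x) * normal_density 0 \<tau> s) \<partial>lborel) \<partial>M)"
    by (simp add: nn_integral_exp_mult_normal_density \<tau>)
  also have "\<dots> = (\<integral>\<^sup>+ s. (\<integral>\<^sup>+ x. ennreal (exp (s * X x) * normal_density 0 \<tau> s) \<partial>M) \<partial>lborel)"
    \<comment> \<open>Tonelli: after the swap, the hypothesis on the moment generating function
      applies for each fixed \<open>s\<close>.\<close>
    by (rule Fubini'[symmetric]) measurable
  also have "\<dots> \<le> (\<integral>\<^sup>+ s. ennreal (exp (\<sigma>\<^sup>2 / 2 * s\<^sup>2) * normal_density 0 \<tau> s) \<partial>lborel)"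
    using mgf by (intro nn_integral_mono) (simp add: ennreal_mult nn_integral_multc mult_right_mono)
  also have "\<dots> = ennreal (1 / sqrt (1 - 2 * (\<sigma>\<^sup>2 / 2) * \<tau>\<^sup>2))"
    by (rule nn_integral_exp_square_normal_density) (use \<tau> \<sigma> in auto)
  also have "\<dots> = 2"
    using \<sigma> by (simp add: \<tau>(2) real_sqrt_divide)
  finally show ?thesis .
qed

lemma subgaussian_norm_le:
  assumes X: "centered_rv M X"
  shows "ennreal (sqrt (3/8)) * subgaussian_norm M X \<le> subgaussian_param M X"
  unfolding subgaussian_param_def
proof (rule Inf_greatest, clarify)
  interpret prob_space M using X by (simp add: centered_rv_def)
  have EX: "expectation X = 0" and [measurable]: "random_variable borel X"
    using X by (auto simp: centered_rv_def)
  fix \<sigma> :: real assume \<sigma>: "0 \<le> \<sigma>"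
    and mgf: "\<forall>s. (\<integral>\<^sup>+ x. ennreal (exp (s * (X x - expectation X))) \<partial>M) \<le> ennreal (exp (\<sigma>\<^sup>2 * s\<^sup>2 / 2))"
  show "ennreal (sqrt (3/8)) * subgaussian_norm M X \<le> ennreal \<sigma>"
  \<comment> \<open>enlarging \<open>\<sigma>\<close> by \<open>e > 0\<close> also covers \<open>\<sigma> = 0\<close>\<close>
  proof (rule ennreal_le_epsilon)
    fix e :: real assume e: "0 < e"
    define \<rho> where "\<rho> = \<sigma> + e"
    have \<rho>: "\<rho> > 0" using \<sigma> e by (simp add: \<rho>_def)
    have "\<sigma>\<^sup>2 \<le> \<rho>\<^sup>2" using \<sigma> e by (intro power_mono) (auto simp: \<rho>_def)
    then have "ennreal (exp (\<sigma>\<^sup>2 * s\<^sup>2 / 2)) \<le> ennreal (exp (\<rho>\<^sup>2 * s\<^sup>2 / 2))" for s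
      by (intro ennreal_leI) (simp add: mult_right_mono)
    then have "(\<integral>\<^sup>+ x. ennreal (exp (s * X x)) \<partial>M) \<le> ennreal (exp (\<rho>\<^sup>2 * s\<^sup>2 / 2))" for s
      using mgf[rule_format, of s] unfolding EX diff_zero by (rule order_trans[rotated])
    then have "(\<integral>\<^sup>+ x. ennreal (exp ((X x)\<^sup>2 / (sqrt (8/3) * \<rho>)\<^sup>2)) \<partial>M) \<le> 2"
      using \<rho> by (intro nn_sq_exp_le_of_nn_mgf_le) auto
    then have "subgaussian_norm M X \<le> ennreal (sqrt (8/3) * \<rho>)"
      unfolding subgaussian_norm_def using \<rho> by (intro Inf_lower) auto
    then have "ennreal (sqrt (3/8)) * subgaussian_norm M X \<le>
        ennreal (sqrt (3/8)) * ennreal (sqrt (8/3) * \<rho>)"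
      by (rule mult_left_mono) simp
    also have "\<dots> = ennreal (sqrt (3/8) * sqrt (8/3) * \<rho>)"
      using \<rho> by (simp add: mult.assoc flip: ennreal_mult)
    also have "sqrt (3/8) * sqrt (8/3) = 1" by (simp flip: real_sqrt_mult)
    finally show "ennreal (sqrt (3/8)) * subgaussian_norm M X \<le> ennreal \<sigma> + ennreal e"
      using \<sigma> e by (simp add: \<rho>_def ennreal_plus)
  qed
qed

section \<open>Sharpness\<close>

lemma nn_integral_std_normal:
  "f \<in> borel_measurable borel \<Longrightarrow> (\<And>x. 0 \<le> f x) \<Longrightarrow>
    (\<integral>\<^sup>+ x. ennreal (f x) \<partial>density lborel std_normal_density) =
    (\<integral>\<^sup>+ x. ennreal (f x * std_normal_density x) \<partial>lborel)"
  by (subst nn_integral_density) (auto simp: mult.commute simp flip: ennreal_mult)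

lemma centered_std_normal: "centered_rv (density lborel std_normal_density) (\<lambda>x. x)"
proof -
  have "has_bochner_integral lborel (\<lambda>x. std_normal_density x * x) 0"
    by (rule normal_moment_nz_1) simp
  then show ?thesis
    unfolding centered_rv_def
    by (auto simp: prob_space_normal_density integrable_density integral_density
        has_bochner_integral_iff)
qed

lemma subgaussian_param_std_normal:
  "subgaussian_param (density lborel std_normal_density) (\<lambda>x. x) \<le> 1"
  unfolding subgaussian_param_def
proof (rule Inf_lower, intro CollectI exI conjI allI)
  have "integral\<^sup>L (density lborel std_normal_density) (\<lambda>x. x) = 0"
    using centered_std_normal by (simp add: centered_rv_def)
  then show "(\<integral>\<^sup>+ x. ennreal (exp (s * (x - integral\<^sup>L (density lborel std_normal_density) (\<lambda>x. x))))
        \<partial>density lborel std_normal_density) \<le> ennreal (exp (1\<^sup>2 * s\<^sup>2 / 2))" for s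
    using nn_integral_exp_mult_normal_density[of 1 s]
    by (simp add: nn_integral_std_normal mult.commute)
qed auto

text \<open>E exp(aX^2) = 1/sqrt(1 - 2a) is at most 2 only if a <= 3/8.\<close>

lemma subgaussian_norm_std_normal:
  "ennreal (sqrt (8/3)) \<le> subgaussian_norm (density lborel std_normal_density) (\<lambda>x. x)"
  unfolding subgaussian_norm_def
proof (rule Inf_greatest, clarify)
  fix K :: real assume K: "0 < K"
    and le2: "(\<integral>\<^sup>+ x. ennreal (exp (x\<^sup>2 / K\<^sup>2)) \<partial>density lborel std_normal_density) \<le> 2"
  \<comment> \<open>\<open>a\<close> is capped at \<open>2/5 < 1/2\<close> to keep the Gaussian integral finite\<close>
  define a where "a = min (1 / K\<^sup>2) (2/5)"
  have a: "2 * a < 1" "0 < a" using K by (auto simp: a_def)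
  have "ennreal (1 / sqrt (1 - 2 * a)) =
      (\<integral>\<^sup>+ x. ennreal (exp (a * x\<^sup>2)) \<partial>density lborel std_normal_density)"
    using nn_integral_exp_square_normal_density[of 1 a] a by (simp add: nn_integral_std_normal)
  also have "\<dots> \<le> (\<integral>\<^sup>+ x. ennreal (exp (x\<^sup>2 / K\<^sup>2)) \<partial>density lborel std_normal_density)"
  proof (intro nn_integral_mono ennreal_leI)
    fix x :: real
    have "a * x\<^sup>2 \<le> 1 / K\<^sup>2 * x\<^sup>2" by (intro mult_right_mono) (auto simp: a_def)
    then show "exp (a * x\<^sup>2) \<le> exp (x\<^sup>2 / K\<^sup>2)" by simp
  qed
  also note le2
  finally have "ennreal (1 / sqrt (1 - 2 * a)) \<le> ennreal 2" by simp
  then have "1 / sqrt (1 - 2 * a) \<le> 2"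
    by (subst (asm) ennreal_le_iff) auto
  then have "sqrt (1/4) \<le> sqrt (1 - 2 * a)"
    using a by (simp add: field_simps real_sqrt_divide)
  then have "a \<le> 3/8" by simp
  \<comment> \<open>As 3/8 < 2/5, the minimum defining \<open>a\<close> cannot be the cap, so it is
    1/K^2.\<close>
  then have "1 / K\<^sup>2 \<le> 3/8" by (auto simp: a_def min_def split: if_splits)
  then have "8/3 \<le> K\<^sup>2" using K by (simp add: field_simps)
  then have "sqrt (8/3) \<le> K" using K by (simp add: real_le_lsqrt)
  then show "ennreal (sqrt (8/3)) \<le> ennreal K" by (rule ennreal_leI)
qed

section \<open>Extremal example for the upper bound: the random sign\<close>

abbreviation sign_pmf :: "real pmf" where
  "sign_pmf \<equiv> pmf_of_set {-1, 1}"

lemma nn_integral_sign_pmf: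
  "(\<And>x. 0 \<le> f x) \<Longrightarrow> (\<integral>\<^sup>+ x. ennreal (f x) \<partial>measure_pmf sign_pmf) = ennreal ((f (-1) + f 1) / 2)"
  by (subst nn_integral_pmf_of_set) (auto simp: ennreal_divide_numeral simp flip: ennreal_plus)

lemma integral_sign_pmf: "integral\<^sup>L (measure_pmf sign_pmf) f = (f (-1) + f 1 :: real) / 2"
  by (subst integral_pmf_of_set) auto

lemma centered_sign: "centered_rv (measure_pmf sign_pmf) (\<lambda>x. c * x)"
  unfolding centered_rv_def
  by (auto simp: integral_sign_pmf measure_pmf.prob_space_axioms intro!: integrable_measure_pmf_finite)

text \<open>Here X^2 is constantly ln 2, so K = 1 gives E exp(X^2) = 2.\<close>

lemma subgaussian_norm_sign:
  "subgaussian_norm (measure_pmf sign_pmf) (\<lambda>x. sqrt (ln 2) * x) \<le> 1"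
  unfolding subgaussian_norm_def
  by (rule Inf_lower) (auto simp: nn_integral_sign_pmf power_mult_distrib intro!: exI[of _ 1])

text \<open>Since cosh(2u) - 1 = 2 sinh(u)^2, it suffices that sinh u >= u for u >= 0. This follows
  from the quadratic Taylor bound for exp u and the reciprocal bound for exp(-u).\<close>

lemma one_plus_half_square_le_cosh: "1 + x\<^sup>2 / 2 \<le> cosh (x :: real)"
proof -
  define u where "u = \<bar>x\<bar> / 2"
  have u: "0 \<le> u" by (simp add: u_def)
  let ?p = "1 + u + u\<^sup>2 / 2"
  have p: "?p \<le> exp u" by (rule exp_lower_Taylor_quadratic[OF u])
  have p0: "?p > 0" using u by (simp add: add_pos_nonneg)
  have "exp (- u) \<le> 1 / ?p"
    using p p0 by (simp add: exp_minus inverse_eq_divide frac_le)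
  also have "1 / ?p \<le> 1 - u + u\<^sup>2 / 2"
  proof -
    \<comment> \<open>The product is (1 + u^2/2)^2 - u^2, hence at least 1.\<close>
    have "(1 - u + u\<^sup>2 / 2) * ?p = 1 + (u\<^sup>2)\<^sup>2 / 4"
      by (simp add: field_simps power2_eq_square)
    then show ?thesis using p0 by (subst pos_divide_le_eq) auto
  qed
  finally have "2 * u \<le> exp u - exp (- u)" using p by linarith
  then have "(2 * u)\<^sup>2 \<le> (exp u - exp (- u))\<^sup>2" using u by (intro power_mono) auto
  also have "\<dots> = (exp u)\<^sup>2 + (exp (- u))\<^sup>2 - 2 * (exp u * exp (- u))"
    by (simp add: power2_diff)
  also have "\<dots> = exp (2 * u) + exp (- (2 * u)) - 2"
    by (simp add: power2_eq_square flip: exp_add)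
  finally have "1 + (2 * u)\<^sup>2 / 2 \<le> cosh (2 * u)" by (simp add: cosh_def)
  then show ?thesis by (simp add: u_def)
qed

text \<open>Compares the coefficients of s^2 as s tends to 0, in quantitative form with s^2 =
  v.\<close>

lemma sq_le_if_cosh_le_exp:
  fixes a b :: real
  assumes "\<And>s. cosh (s * a) \<le> exp (b * s\<^sup>2 / 2)" and b: "0 \<le> b"
  shows "a\<^sup>2 \<le> b"
proof (rule field_le_epsilon)
  fix e :: real assume e: "0 < e"
  \<comment> \<open>The first entry gives b v/2 <= 1, as \<open>exp_bound\<close> requires; the
    second makes the error b^2 v/2 at most \<open>e\<close>. Adding 1 keeps the denominators
    positive when b = 0.\<close>
  define v where "v = min (2 / (b + 1)) (2 * e / (b\<^sup>2 + 1))"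
  have v: "v > 0" using e b by (auto simp: v_def intro!: divide_pos_pos add_nonneg_pos)
  have bv: "b * v / 2 \<le> 1"
  proof -
    have "v * (b + 1) \<le> 2" using b by (simp add: v_def pos_le_divide_eq[symmetric])
    then show ?thesis using v by (simp add: algebra_simps)
  qed
  have ev: "b\<^sup>2 * v / 2 \<le> e"
  proof -
    have "b\<^sup>2 + 1 > 0" by (simp add: add_nonneg_pos)
    then have "v * (b\<^sup>2 + 1) \<le> 2 * e" by (simp add: v_def pos_le_divide_eq[symmetric])
    then show ?thesis using v by (simp add: algebra_simps)
  qed
  have "1 + (sqrt v * a)\<^sup>2 / 2 \<le> exp (b * (sqrt v)\<^sup>2 / 2)"
    using one_plus_half_square_le_cosh[of "sqrt v * a"] assms(1)[of "sqrt v"] by linarith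
  then have "1 + v * a\<^sup>2 / 2 \<le> exp (b * v / 2)"
    using v by (simp add: power_mult_distrib)
  also have "\<dots> \<le> 1 + b * v / 2 + (b * v / 2)\<^sup>2"
    by (rule exp_bound) (use b v bv in auto)
  finally have "v * a\<^sup>2 \<le> v * (b + b\<^sup>2 * v / 2)"
    by (simp add: power2_eq_square algebra_simps)
  then have "a\<^sup>2 \<le> b + b\<^sup>2 * v / 2" using v by simp
  then show "a\<^sup>2 \<le> b + e" using ev by linarith
qed

text \<open>The moment generating function is cosh(s c), whose second-order term at 0 bounds every
  admissible parameter from below.\<close>

lemma subgaussian_param_sign:
  assumes "0 \<le> c"
  shows "ennreal c \<le> subgaussian_param (measure_pmf sign_pmf) (\<lambda>x. c * x)"
  unfolding subgaussian_param_def
proof (rule Inf_greatest, clarify)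
  fix \<sigma> :: real assume \<sigma>: "0 \<le> \<sigma>"
    and mgf: "\<forall>s. (\<integral>\<^sup>+ x. ennreal (exp (s * (c * x - integral\<^sup>L (measure_pmf sign_pmf) (\<lambda>x. c * x))))
        \<partial>measure_pmf sign_pmf) \<le> ennreal (exp (\<sigma>\<^sup>2 * s\<^sup>2 / 2))"
  have "cosh (s * c) \<le> exp (\<sigma>\<^sup>2 * s\<^sup>2 / 2)" for s
  proof -
    have "ennreal (cosh (s * c)) \<le> ennreal (exp (\<sigma>\<^sup>2 * s\<^sup>2 / 2))"
      using mgf[rule_format, of s]
      by (simp add: integral_sign_pmf nn_integral_sign_pmf cosh_def add.commute)
    then show ?thesis by (subst (asm) ennreal_le_iff) auto
  qed
  then have "c\<^sup>2 \<le> \<sigma>\<^sup>2" by (rule sq_le_if_cosh_le_exp) simp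
  then have "c \<le> \<sigma>" using \<sigma> by (rule power2_le_imp_le)
  then show "ennreal c \<le> ennreal \<sigma>" by (rule ennreal_leI)
qed

text \<open>The bounds hold over every sample space. Sharpness is stated for measures on the reals,
  where both extremal examples live; an arbitrary type \<open>'a\<close> could be a single point,
  carrying no nonzero centered variable.\<close>

theorem theorem1p1:
  shows "(\<forall>(M :: 'a measure) X. centered_rv M X \<longrightarrow>
            ennreal (sqrt (3/8)) * subgaussian_norm M X \<le> subgaussian_param M X \<and>
            subgaussian_param M X \<le> ennreal (sqrt (ln 2)) * subgaussian_norm M X)
    \<and> (\<forall>c :: real. c > sqrt (3/8) \<longrightarrow>
          \<not> (\<forall>(M :: real measure) X. centered_rv M X \<longrightarrow>
                ennreal c * subgaussian_norm M X \<le> subgaussian_param M X))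
    \<and> (\<forall>c :: real. c < sqrt (ln 2) \<longrightarrow>
          \<not> (\<forall>(M :: real measure) X. centered_rv M X \<longrightarrow>
                subgaussian_param M X \<le> ennreal c * subgaussian_norm M X))"
proof (intro conjI allI impI notI)
  fix M :: "'a measure" and X assume X: "centered_rv M X"
  show "ennreal (sqrt (3/8)) * subgaussian_norm M X \<le> subgaussian_param M X"
    using X by (rule subgaussian_norm_le)
  show "subgaussian_param M X \<le> ennreal (sqrt (ln 2)) * subgaussian_norm M X"
    using X by (rule subgaussian_param_le)
next
  fix c :: real assume c: "c > sqrt (3/8)"
    and H: "\<forall>(M :: real measure) X. centered_rv M X \<longrightarrow>
      ennreal c * subgaussian_norm M X \<le> subgaussian_param M X"
  have c0: "0 \<le> c" using c by (meson less_imp_le order_trans real_sqrt_ge_zero zero_le_divide_iff zero_le_numeral)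
  let ?N = "density lborel std_normal_density"
  have "ennreal (c * sqrt (8/3)) = ennreal c * ennreal (sqrt (8/3))"
    using c0 by (simp add: ennreal_mult)
  also have "\<dots> \<le> ennreal c * subgaussian_norm ?N (\<lambda>x. x)"
    by (intro mult_left_mono subgaussian_norm_std_normal) simp
  also have "\<dots> \<le> 1"
    using H centered_std_normal subgaussian_param_std_normal order_trans by blast
  finally have "c * sqrt (8/3) \<le> 1" by (simp add: ennreal_le_1)
  moreover have "sqrt (3/8) * sqrt (8/3) < c * sqrt (8/3)"
    using c by (intro mult_strict_right_mono) auto
  moreover have "sqrt (3/8) * sqrt (8/3) = 1" by (simp flip: real_sqrt_mult)
  ultimately show False by linarith
next
  fix c :: real assume c: "c < sqrt (ln 2)"
    and H: "\<forall>(M :: real measure) X. centered_rv M X \<longrightarrow>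
      subgaussian_param M X \<le> ennreal c * subgaussian_norm M X"
  have "ennreal (sqrt (ln 2)) \<le> subgaussian_param (measure_pmf sign_pmf) (\<lambda>x. sqrt (ln 2) * x)"
    by (rule subgaussian_param_sign) simp
  also have "\<dots> \<le> ennreal c * subgaussian_norm (measure_pmf sign_pmf) (\<lambda>x. sqrt (ln 2) * x)"
    using H centered_sign by blast
  also have "\<dots> \<le> ennreal c * 1"
    by (intro mult_left_mono subgaussian_norm_sign) simp
  \<comment> \<open>A negative \<open>c\<close> is truncated to 0 by \<open>ennreal\<close>; the
    inequality stays strict because sqrt(ln 2) > 0.\<close>
  also have "\<dots> < ennreal (sqrt (ln 2))"
    using c by (simp add: ennreal_less_iff ennreal_lessI)
  finally show False by simp
qed

end
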